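(* Consider the Poisson $i\mathcal{S}$-graph with legitimate-node density $\lambda_\ell>0$, eavesdropper density $\lambda_{\mathrm e}>0$, transmit power $P_\ell>0$, secrecy rate threshold $\varrho\ge0$, noise powers $\sigma_\ell^2,\sigma_{\mathrm e}^2>0$, path loss only, and any channel gain function $g:(0,\infty)\to(0,\infty)$ that is continuous, strictly decreasing, and satisfies $\lim_{r\to\infty}g(r)=0$. Then the average node degrees $\mathbb{E}\{N_{\mathrm{out}}\}=\mathbb{E}\{N_{\mathrm{in}}\}$ of a typical node are decreasing (non-increasing) functions of $\varrho$ and of $\sigma_\ell^2$, and increasing (non-decreasing) functions of $\sigma_{\mathrm e}^2$ (in each case with the other parameters held fixed).
   Context: $\Pi_\ell$ (legitimate nodes) and $\Pi_{\mathrm e}$ (eavesdroppers) are mutually independent homogeneous Poisson point processes on $\mathbb{R}^2$ with densities $\lambda_\ell,\lambda_{\mathrm e}$. $i\mathcal{S}$-graph: the directed graph on the legitimate nodes with edge $\overrightarrow{xy}$ between distinct nodes if and only if $$g(|x-y|)>\frac{\sigma_\ell^2}{\sigma_{\mathrm e}^2}2^{\varrho}g(|x-e^*|)+\frac{\sigma_\ell^2}{P_\ell}(2^{\varrho}-1),\qquad e^*=\operatorname*{argmin}_{e\in\Pi_{\mathrm e}}|x-e|.$$ (This is equivalent to the maximum secrecy rate $\left[\log_2(1+P_\ell g(|x-y|)/\sigma_\ell^2)-\log_2(1+P_\ell g(|x-e^*|)/\sigma_{\mathrm e}^2)\right]^+$ exceeding $\varrho$.) Typical node: the node at the origin when the graph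 is built on the legitimate-node set $\Pi_\ell\cup\{0\}$ with eavesdroppers $\Pi_{\mathrm e}$. $N_{\mathrm{out}}$ (resp. $N_{\mathrm{in}}$) is the number of $x\in\Pi_\ell$ with an edge $\overrightarrow{0x}$ (resp. $\overrightarrow{x0}$). Expectations may take the value $+\infty$. *)

theory Defs
  imports "HOL-Probability.Probability"
begin

section \<open>Poisson point processes in the plane\<close>

type_synonym point = "real ^ 2"

text \<open>
  A simple point process is a random locally finite set of points. Its randomness is accessed only
  through the numbers of points in bounded Borel sets, which are finite by local finiteness.
\<close>

definition bounded_borel :: "point set set" where
  "bounded_borel = {B. B \<in> sets borel \<and> bounded B}"

definition point_count :: "('w \<Rightarrow> point set) \<Rightarrow> point set \<Rightarrow> 'w \<Rightarrow> nat" where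
  "point_count \<Phi> B \<omega> = card (\<Phi> \<omega> \<inter> B)"

text \<open>
  The Poisson probabilities are written out, because \<^const>\<open>poisson_pmf\<close> is only meaningful for a
  positive mean, whereas here the mean vanishes on Lebesgue null sets (with \<open>0 ^ 0 = 1\<close>).
\<close>

definition homogeneous_poisson_process :: "'w measure \<Rightarrow> real \<Rightarrow> ('w \<Rightarrow> point set) \<Rightarrow> bool" where
  "homogeneous_poisson_process M l \<Phi> \<longleftrightarrow>
     prob_space M \<and>
     (\<forall>\<omega>\<in>space M. \<forall>B. bounded B \<longrightarrow> finite (\<Phi> \<omega> \<inter> B)) \<and>
     (\<forall>B\<in>bounded_borel. point_count \<Phi> B \<in> measurable M (count_space UNIV)) \<and>
     (\<forall>B\<in>bounded_borel. \<forall>k.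
        measure M {\<omega> \<in> space M. point_count \<Phi> B \<omega> = k} =
        (l * measure lborel B) ^ k / fact k * exp (- (l * measure lborel B))) \<and>
     (\<forall>F. finite F \<and> F \<subseteq> bounded_borel \<and> disjoint F \<longrightarrow>
        prob_space.indep_vars M (\<lambda>_. count_space UNIV) (point_count \<Phi>) F)"

definition process_events :: "'w measure \<Rightarrow> ('w \<Rightarrow> point set) \<Rightarrow> 'w set set" where
  "process_events M \<Phi> = sigma_sets (space M)
     {{\<omega> \<in> space M. point_count \<Phi> B \<omega> = k} | B k. B \<in> bounded_borel}"

definition indep_processes ::
  "'w measure \<Rightarrow> ('w \<Rightarrow> point set) \<Rightarrow> ('w \<Rightarrow> point set) \<Rightarrow> bool" where
  "indep_processes M \<Phi> \<Phi>' \<longleftrightarrow>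
     prob_space.indep_set M (process_events M \<Phi>) (process_events M \<Phi>')"


section \<open>The secrecy graph and the degrees of the typical node\<close>

text \<open>
  If several eavesdroppers are at minimal distance, one of them is chosen; only its distance matters
  below. The value for an empty set of eavesdroppers is unspecified.
\<close>

definition nearest :: "point set \<Rightarrow> point \<Rightarrow> point" where
  "nearest E x = arg_min_on (\<lambda>e. dist x e) E"

text \<open>
  The arguments \<open>sl\<close> and \<open>se\<close> are the noise powers $\sigma_\ell^2$ and $\sigma_{\mathrm e}^2$
  themselves, not their square roots. \<open>V\<close> is the set of legitimate nodes and \<open>E\<close> that of the
  eavesdroppers.
\<close>

definition iS_graph ::
  "(real \<Rightarrow> real) \<Rightarrow> real \<Rightarrow> real \<Rightarrow> real \<Rightarrow> real \<Rightarrow> point set \<Rightarrow> point set \<Rightarrow> (point \<times> point) set" where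
  "iS_graph g P rho sl se V E =
     {(x, y). x \<in> V \<and> y \<in> V \<and> x \<noteq> y \<and>
        g (dist x y) > sl / se * 2 powr rho * g (dist x (nearest E x)) + sl / P * (2 powr rho - 1)}"

text \<open>
  Degrees and their expectations are extended nonnegative reals; counting measure is used rather
  than \<^const>\<open>card\<close> so that an infinite degree counts as \<open>\<infinity>\<close>.
\<close>

definition N_out ::
  "(real \<Rightarrow> real) \<Rightarrow> real \<Rightarrow> real \<Rightarrow> real \<Rightarrow> real \<Rightarrow> point set \<Rightarrow> point set \<Rightarrow> ennreal" where
  "N_out g P rho sl se L E =
     emeasure (count_space UNIV) {x \<in> L. (0, x) \<in> iS_graph g P rho sl se (L \<union> {0}) E}"

definition N_in ::
  "(real \<Rightarrow> real) \<Rightarrow> real \<Rightarrow> real \<Rightarrow> real \<Rightarrow> real \<Rightarrow> point set \<Rightarrow> point set \<Rightarrow> ennreal" where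
  "N_in g P rho sl se L E =
     emeasure (count_space UNIV) {x \<in> L. (x, 0) \<in> iS_graph g P rho sl se (L \<union> {0}) E}"

definition mean_out_degree ::
  "'w measure \<Rightarrow> ('w \<Rightarrow> point set) \<Rightarrow> ('w \<Rightarrow> point set) \<Rightarrow>
   (real \<Rightarrow> real) \<Rightarrow> real \<Rightarrow> real \<Rightarrow> real \<Rightarrow> real \<Rightarrow> ennreal" where
  "mean_out_degree M \<Phi>l \<Phi>e g P rho sl se = (\<integral>\<^sup>+\<omega>. N_out g P rho sl se (\<Phi>l \<omega>) (\<Phi>e \<omega>) \<partial>M)"

definition mean_in_degree ::
  "'w measure \<Rightarrow> ('w \<Rightarrow> point set) \<Rightarrow> ('w \<Rightarrow> point set) \<Rightarrow>
   (real \<Rightarrow> real) \<Rightarrow> real \<Rightarrow> real \<Rightarrow> real \<Rightarrow> real \<Rightarrow> ennreal" where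
  "mean_in_degree M \<Phi>l \<Phi>e g P rho sl se = (\<integral>\<^sup>+\<omega>. N_in g P rho sl se (\<Phi>l \<omega>) (\<Phi>e \<omega>) \<partial>M)"

end

theory Submission
  imports Defs
begin

text \<open>
  Campbell's formula for the legitimate nodes, with the independent eavesdropper process as a mark,
  writes both mean degrees as $\lambda_\ell$ times the integral over $x$ of the probability that
  $g(|x|)$ exceeds the secrecy threshold at the distance from the transmitter to its nearest
  eavesdropper. The transmitter is $0$ for the out-degree and $x$ for the in-degree; by
  stationarity this distance has the same law at every point, so the two integrals coincide. The
  threshold is monotone in each parameter for a fixed distance, and so is the integral.
\<close>

section \<open>Counts of a Poisson process\<close>

text \<open>The processes are accessible only through their counts in bounded Borel sets, so
  Campbell's formula has to be built from these. Independence gives it for sets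
  \<open>B \<times> C\<close> with \<open>C\<close> an event of the eavesdropper counts, and a
  pi-lambda argument extends it to the product sigma-algebra. The price is that a mark must be
  measurable jointly in position and outcome with respect to the sigma-algebra of the eavesdropper
  counts, not merely with respect to \<open>M\<close>. The argmin is opaque for this purpose and is
  traded for \<open>infdist\<close>, which equals the distance to the argmin when the set is
  nonempty and locally finite. Two degenerate cases remain: \<open>infdist x {} = 0\<close>, and a
  transmitter sitting on an eavesdropper, which would involve \<open>g 0\<close>. Both have
  probability zero. Stationarity is not a hypothesis; what is used of it follows from the void
  probabilities of discs, which depend on the area alone.\<close>

abbreviation ecount :: "point set \<Rightarrow> ennreal" where
  "ecount A \<equiv> emeasure (count_space UNIV) A"

text \<open>The generated sigma-algebra is packaged as a measure so that it can be a factor of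
  \<open>\<Otimes>\<^sub>M\<close>. It only supplies a space and measurable sets; probabilities are
  always taken under \<open>M\<close>.\<close>

definition process_algebra :: "'w measure \<Rightarrow> ('w \<Rightarrow> point set) \<Rightarrow> 'w measure" where
  "process_algebra M \<Phi> = sigma (space M)
     {{\<omega> \<in> space M. point_count \<Phi> B \<omega> = k} | B k. B \<in> bounded_borel}"

lemma space_process_algebra [simp]: "space (process_algebra M \<Phi>) = space M"
  by (auto simp: process_algebra_def intro!: space_measure_of)

lemma sets_process_algebra: "sets (process_algebra M \<Phi>) = process_events M \<Phi>"
  unfolding process_algebra_def process_events_def by (rule sets_measure_of) auto

lemma count_event_in_process_algebra:
  assumes "B \<in> bounded_borel"
  shows "{\<omega> \<in> space M. point_count \<Phi> B \<omega> = k} \<in> sets (process_algebra M \<Phi>)"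
  using assms unfolding sets_process_algebra process_events_def by (intro sigma_sets.Basic) auto

lemma count_event_in_sets:
  assumes "homogeneous_poisson_process M l \<Phi>" "B \<in> bounded_borel"
  shows "{\<omega> \<in> space M. point_count \<Phi> B \<omega> = k} \<in> sets M"
proof -
  have [measurable]: "point_count \<Phi> B \<in> measurable M (count_space UNIV)"
    using assms by (auto simp: homogeneous_poisson_process_def)
  show ?thesis by measurable
qed

lemma sets_process_algebra_subset:
  assumes "homogeneous_poisson_process M l \<Phi>"
  shows "sets (process_algebra M \<Phi>) \<subseteq> sets M"
  unfolding sets_process_algebra process_events_def
  by (rule sets.sigma_sets_subset) (use count_event_in_sets[OF assms] in auto)

lemma hitting_event_in_process_algebra:
  assumes "homogeneous_poisson_process M l \<Phi>" "B \<in> bounded_borel"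
  shows "{\<omega> \<in> space M. \<Phi> \<omega> \<inter> B \<noteq> {}} \<in> sets (process_algebra M \<Phi>)"
proof -
  \<comment> \<open>\<open>card\<close> is also 0 on infinite sets, so a zero count means an empty
    intersection only because of local finiteness.\<close>
  have "finite (\<Phi> \<omega> \<inter> B)" if "\<omega> \<in> space M" for \<omega>
    using assms that by (auto simp: homogeneous_poisson_process_def bounded_borel_def)
  hence "{\<omega> \<in> space M. \<Phi> \<omega> \<inter> B \<noteq> {}} =
      space (process_algebra M \<Phi>) - {\<omega> \<in> space M. point_count \<Phi> B \<omega> = 0}"
    by (auto simp: point_count_def)
  thus ?thesis
    by (simp only:) (rule sets.compl_sets, rule count_event_in_process_algebra[OF assms(2)])
qed

section \<open>Void probabilities and their almost sure consequences\<close>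

lemma void_probability:
  assumes "homogeneous_poisson_process M l \<Phi>" "B \<in> bounded_borel"
  shows "measure M {\<omega> \<in> space M. \<Phi> \<omega> \<inter> B = {}} = exp (- (l * measure lborel B))"
proof -
  have fin: "finite (\<Phi> \<omega> \<inter> B)" if "\<omega> \<in> space M" for \<omega>
    using assms that by (auto simp: homogeneous_poisson_process_def bounded_borel_def)
  have "{\<omega> \<in> space M. \<Phi> \<omega> \<inter> B = {}} = {\<omega> \<in> space M. point_count \<Phi> B \<omega> = 0}"
    using fin by (auto simp: point_count_def)
  thus ?thesis using assms by (simp add: homogeneous_poisson_process_def)
qed

lemma void_event_in_sets:
  assumes "homogeneous_poisson_process M l \<Phi>" "B \<in> bounded_borel"
  shows "{\<omega> \<in> space M. \<Phi> \<omega> \<inter> B = {}} \<in> sets M"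
proof -
  have "{\<omega> \<in> space M. \<Phi> \<omega> \<inter> B = {}} = space M - {\<omega> \<in> space M. \<Phi> \<omega> \<inter> B \<noteq> {}}" by auto
  thus ?thesis
    using hitting_event_in_process_algebra[OF assms] sets_process_algebra_subset[OF assms(1)]
    by (auto intro!: sets.Diff)
qed

lemma cball_bounded_borel: "cball x r \<in> bounded_borel"
  by (simp add: bounded_borel_def)

lemma ball_bounded_borel: "ball x r \<in> bounded_borel"
  by (simp add: bounded_borel_def)

lemma AE_point_notin_poisson:
  assumes "homogeneous_poisson_process M l \<Phi>"
  shows "AE \<omega> in M. x \<notin> \<Phi> \<omega>"
proof -
  interpret prob_space M using assms by (simp add: homogeneous_poisson_process_def)
  have B: "{x} \<in> bounded_borel" by (auto simp: bounded_borel_def)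
  have "prob {\<omega> \<in> space M. \<Phi> \<omega> \<inter> {x} = {}} = 1"
    using void_probability[OF assms B] by simp
  hence "AE \<omega> in M. \<Phi> \<omega> \<inter> {x} = {}"
    by (rule iffD1[OF prob_Collect_eq_1[OF void_event_in_sets[OF assms B]]])
  thus ?thesis by eventually_elim auto
qed

lemma AE_poisson_nonempty:
  assumes "homogeneous_poisson_process M l \<Phi>" "l > 0"
  shows "AE \<omega> in M. \<Phi> \<omega> \<noteq> {}"
proof -
  interpret prob_space M using assms by (simp add: homogeneous_poisson_process_def)
  \<comment> \<open>The radius \<open>sqrt (real n)\<close> makes the area linear in
    \<open>n\<close>, so the void probabilities form a geometric sequence. An empty configuration
    lies in every \<open>V n\<close>.\<close>
  define V where "V n = {\<omega> \<in> space M. \<Phi> \<omega> \<inter> cball 0 (sqrt (real n)) = {}}" for n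
  have V: "V n \<in> sets M" for n
    unfolding V_def by (rule void_event_in_sets[OF assms(1) cball_bounded_borel])
  define c where "c = l * unit_ball_vol (real DIM(point))"
  have c: "c > 0" using assms(2) by (simp add: c_def)
  have pV: "prob (V n) = exp (- c) ^ n" for n
    unfolding V_def void_probability[OF assms(1) cball_bounded_borel]
    by (simp add: content_cball c_def mult_ac flip: exp_of_nat_mult)
  have "prob (\<Inter>n. V n) \<le> exp (- c) ^ n" for n
    unfolding pV[symmetric] by (rule finite_measure_mono) (auto intro: V)
  moreover have "(\<lambda>n. exp (- c) ^ n) \<longlonglongrightarrow> 0"
    using c by (intro LIMSEQ_power_zero) simp
  ultimately have "prob (\<Inter>n. V n) \<le> 0"
    by (intro LIMSEQ_le_const) auto
  moreover have "(\<Inter>n. V n) \<in> sets M"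
    using V by (intro sets.countable_INT) auto
  ultimately have "(\<Inter>n. V n) \<in> null_sets M"
    by (auto simp: null_sets_def emeasure_eq_measure intro!: antisym)
  hence "AE \<omega> in M. \<omega> \<notin> (\<Inter>n. V n)" by (rule AE_not_in)
  thus ?thesis
  proof (rule AE_mp, intro AE_I2 impI)
    fix \<omega> assume "\<omega> \<in> space M" "\<omega> \<notin> (\<Inter>n. V n)"
    thus "\<Phi> \<omega> \<noteq> {}" by (auto simp: V_def)
  qed
qed

section \<open>Mean number of points on an independent event\<close>

lemma nn_integral_nat_valued:
  fixes f :: "'w \<Rightarrow> nat"
  assumes [measurable]: "f \<in> measurable M (count_space UNIV)" "C \<in> sets M"
  shows "(\<integral>\<^sup>+\<omega>. of_nat (f \<omega>) * indicator C \<omega> \<partial>M) =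
    (\<Sum>k. of_nat k * emeasure M ({\<omega> \<in> space M. f \<omega> = k} \<inter> C))"
proof -
  have eq: "of_nat (f \<omega>) * indicator C \<omega> =
      (\<Sum>k. of_nat k * indicator ({\<omega> \<in> space M. f \<omega> = k} \<inter> C) \<omega> :: ennreal)"
    if "\<omega> \<in> space M" for \<omega>
  proof -
    have "(\<Sum>k. of_nat k * indicator ({\<omega> \<in> space M. f \<omega> = k} \<inter> C) \<omega> :: ennreal) =
        (\<Sum>k\<in>{f \<omega>}. of_nat k * indicator ({\<omega> \<in> space M. f \<omega> = k} \<inter> C) \<omega>)"
      by (rule suminf_finite) auto
    thus ?thesis using that by (simp add: indicator_def)
  qed
  have "(\<integral>\<^sup>+\<omega>. of_nat (f \<omega>) * indicator C \<omega> \<partial>M) =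
    (\<integral>\<^sup>+\<omega>. (\<Sum>k. of_nat k * indicator ({\<omega> \<in> space M. f \<omega> = k} \<inter> C) \<omega>) \<partial>M)"
    by (rule nn_integral_cong) (rule eq)
  also have "\<dots> = (\<Sum>k. \<integral>\<^sup>+\<omega>. of_nat k * indicator ({\<omega> \<in> space M. f \<omega> = k} \<inter> C) \<omega> \<partial>M)"
    by (rule nn_integral_suminf) measurable
  also have "\<dots> = (\<Sum>k. of_nat k * emeasure M ({\<omega> \<in> space M. f \<omega> = k} \<inter> C))"
    by (intro suminf_cong nn_integral_cmult_indicator) measurable
  finally show ?thesis .
qed

text \<open>Cancelling \<open>k\<close> against \<open>fact k\<close> shifts the index and leaves
  \<open>\<mu>\<close> times the exponential series. Since \<open>\<mu> = 0\<close> is covered, the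
  formula also serves Lebesgue null sets.\<close>

lemma poisson_mean_sums:
  fixes \<mu> :: real
  shows "(\<lambda>k. real k * (\<mu> ^ k / fact k * exp (- \<mu>))) sums \<mu>"
proof -
  have "(\<lambda>k. \<mu> ^ k / fact k) sums exp \<mu>"
    using exp_converges[of \<mu>] by (simp add: field_simps)
  hence "(\<lambda>k. (\<mu> * exp (- \<mu>)) * (\<mu> ^ k / fact k)) sums ((\<mu> * exp (- \<mu>)) * exp \<mu>)"
    by (rule sums_mult)
  also have "(\<lambda>k. (\<mu> * exp (- \<mu>)) * (\<mu> ^ k / fact k)) =
      (\<lambda>k. real (Suc k) * (\<mu> ^ Suc k / fact (Suc k) * exp (- \<mu>)))"
    by (auto simp: fun_eq_iff field_simps simp del: of_nat_Suc)
  also have "(\<mu> * exp (- \<mu>)) * exp \<mu> = \<mu>" by (simp add: exp_minus)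
  \<comment> \<open>The term at \<open>k = 0\<close>, dropped by the shift, is zero.\<close>
  finally show ?thesis
    by (subst (asm) sums_Suc_iff) simp
qed

lemma indep_processes_emeasure_Int:
  assumes "homogeneous_poisson_process M l \<Phi>" "indep_processes M \<Phi> \<Psi>"
    and "B \<in> bounded_borel" "C \<in> sets (process_algebra M \<Psi>)"
  shows "emeasure M ({\<omega> \<in> space M. point_count \<Phi> B \<omega> = k} \<inter> C) =
    emeasure M {\<omega> \<in> space M. point_count \<Phi> B \<omega> = k} * emeasure M C"
proof -
  interpret prob_space M using assms by (simp add: homogeneous_poisson_process_def)
  have "indep_set (process_events M \<Phi>) (process_events M \<Psi>)"
    using assms(2) by (simp add: indep_processes_def)
  hence "prob ({\<omega> \<in> space M. point_count \<Phi> B \<omega> = k} \<inter> C) =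
    prob {\<omega> \<in> space M. point_count \<Phi> B \<omega> = k} * prob C"
    by (rule indep_setD)
      (use assms(3,4) count_event_in_process_algebra[OF assms(3)] in
        \<open>auto simp: sets_process_algebra\<close>)
  thus ?thesis by (simp add: emeasure_eq_measure ennreal_mult)
qed

text \<open>This is the rectangle \<open>B \<times> C\<close> of Campbell's formula. The Poisson law
  of \<open>\<Phi>\<close> and the independence enter that formula only here: independence splits
  each value of the count from \<open>C\<close>, and the remaining series is the Poisson
  mean.\<close>

lemma mean_count_on_independent_event:
  assumes "homogeneous_poisson_process M l \<Phi>" "l \<ge> 0" "indep_processes M \<Phi> \<Psi>"
    and "homogeneous_poisson_process M l' \<Psi>"
    and "B \<in> bounded_borel" "C \<in> sets (process_algebra M \<Psi>)"
  shows "(\<integral>\<^sup>+\<omega>. of_nat (point_count \<Phi> B \<omega>) * indicator C \<omega> \<partial>M) =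
    ennreal l * (emeasure lborel B * emeasure M C)"
proof -
  interpret prob_space M using assms by (simp add: homogeneous_poisson_process_def)
  have [measurable]: "point_count \<Phi> B \<in> measurable M (count_space UNIV)"
    using assms by (auto simp: homogeneous_poisson_process_def)
  have [measurable]: "C \<in> sets M" using assms sets_process_algebra_subset by blast
  define \<mu> where "\<mu> = l * measure lborel B"
  have \<mu>: "\<mu> \<ge> 0" using assms(2) by (simp add: \<mu>_def)
  have "(\<integral>\<^sup>+\<omega>. of_nat (point_count \<Phi> B \<omega>) * indicator C \<omega> \<partial>M) =
      (\<Sum>k. of_nat k * emeasure M ({\<omega> \<in> space M. point_count \<Phi> B \<omega> = k} \<inter> C))"
    by (rule nn_integral_nat_valued) measurable
  also have "\<dots> = (\<Sum>k. ennreal (real k * (\<mu> ^ k / fact k * exp (- \<mu>))) * emeasure M C)"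
  proof (rule suminf_cong)
    fix k
    have "emeasure M {\<omega> \<in> space M. point_count \<Phi> B \<omega> = k} = ennreal (\<mu> ^ k / fact k * exp (- \<mu>))"
      using assms(1,5) by (simp add: homogeneous_poisson_process_def emeasure_eq_measure \<mu>_def)
    thus "of_nat k * emeasure M ({\<omega> \<in> space M. point_count \<Phi> B \<omega> = k} \<inter> C) =
        ennreal (real k * (\<mu> ^ k / fact k * exp (- \<mu>))) * emeasure M C"
      unfolding indep_processes_emeasure_Int[OF assms(1,3,5,6)]
      by (simp only: ennreal_mult'[OF of_nat_0_le_iff] ennreal_of_nat_eq_real_of_nat mult.assoc)
  qed
  also have "\<dots> = (\<Sum>k. ennreal (real k * (\<mu> ^ k / fact k * exp (- \<mu>)))) * emeasure M C"
    by (rule ennreal_suminf_multc)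
  also have "(\<Sum>k. ennreal (real k * (\<mu> ^ k / fact k * exp (- \<mu>)))) = ennreal \<mu>"
  proof (rule sums_unique[symmetric], subst sums_ennreal)
    show "(\<lambda>k. real k * (\<mu> ^ k / fact k * exp (- \<mu>))) sums \<mu>"
      by (rule poisson_mean_sums)
  qed (use \<mu> in auto)
  also have "ennreal \<mu> = ennreal l * emeasure lborel B"
  proof -
    have "emeasure lborel B \<noteq> \<infinity>"
      using assms(5) emeasure_bounded_finite[of B] by (simp add: bounded_borel_def)
    hence "emeasure lborel B = ennreal (measure lborel B)"
      by (intro emeasure_eq_ennreal_measure) simp
    thus ?thesis
      by (simp only: \<mu>_def ennreal_mult'[OF assms(2)])
  qed
  finally show ?thesis by (simp add: mult.assoc)
qed


section \<open>Campbell's formula with an independent mark\<close>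

lemma sets_borel_process_algebra_subset:
  assumes "homogeneous_poisson_process M l \<Psi>"
  shows "sets (borel \<Otimes>\<^sub>M process_algebra M \<Psi> :: (point \<times> 'w) measure) \<subseteq> sets (lborel \<Otimes>\<^sub>M M)"
proof -
  have "sigma_sets (UNIV \<times> space M)
      {a \<times> b |a b. a \<in> sets (borel::point measure) \<and> b \<in> sets (process_algebra M \<Psi>)}
    \<subseteq> sigma_sets (UNIV \<times> space M) {a \<times> b |a b. a \<in> sets (borel::point measure) \<and> b \<in> sets M}"
    by (rule sigma_sets_mono') (use sets_process_algebra_subset[OF assms] in blast)
  thus ?thesis by (simp add: sets_pair_measure)
qed

text \<open>Induction from rectangles over disjoint unions and complements. Measurability and the
  integral formula are proved together because the formula for a complement or a union needs the
  counts to be measurable. The bounded window \<open>W\<close> keeps both sides finite, as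
  complements require subtraction in \<open>ennreal\<close>.\<close>

lemma campbell_bounded:
  assumes \<Phi>: "homogeneous_poisson_process M l \<Phi>" "l \<ge> 0"
    and \<Psi>: "homogeneous_poisson_process M l' \<Psi>" "indep_processes M \<Phi> \<Psi>"
    and W: "W \<in> bounded_borel"
    and S: "S \<in> sets (borel \<Otimes>\<^sub>M process_algebra M \<Psi>)"
  shows "(\<lambda>\<omega>. ecount {x \<in> \<Phi> \<omega> \<inter> W. (x, \<omega>) \<in> S}) \<in> borel_measurable M \<and>
    (\<integral>\<^sup>+\<omega>. ecount {x \<in> \<Phi> \<omega> \<inter> W. (x, \<omega>) \<in> S} \<partial>M) =
      ennreal l * emeasure (lborel \<Otimes>\<^sub>M M) (S \<inter> W \<times> space M)"
    (is "?P S")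
proof -
  interpret M: prob_space M using assms by (simp add: homogeneous_poisson_process_def)
  let ?N = "process_algebra M \<Psi>" and ?L = "lborel \<Otimes>\<^sub>M M :: (point \<times> 'a) measure"
  have NM: "sets ?N \<subseteq> sets M" by (rule sets_process_algebra_subset[OF \<Psi>(1)])
  have sub: "T \<in> sets ?L" if "T \<in> sets (borel \<Otimes>\<^sub>M ?N)" for T
    using that sets_borel_process_algebra_subset[OF \<Psi>(1)] by blast
  have fin: "finite (\<Phi> \<omega> \<inter> W)" if "\<omega> \<in> space M" for \<omega>
    using \<Phi>(1) W that by (auto simp: homogeneous_poisson_process_def bounded_borel_def)
  have Wb: "W \<in> sets borel" using W by (simp add: bounded_borel_def)
  have WL: "W \<times> space M \<in> sets ?L" using Wb by auto
  have Wfin: "emeasure ?L (W \<times> space M) < \<infinity>"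
    using W emeasure_bounded_finite[of W] Wb
    by (subst M.emeasure_pair_measure_Times) (auto simp: bounded_borel_def M.emeasure_space_1)
  have rect: "?P (B \<times> C)" if B: "B \<in> sets borel" and C: "C \<in> sets ?N" for B C
  proof -
    have BW: "B \<inter> W \<in> bounded_borel"
      using B W by (auto simp: bounded_borel_def)
    have [measurable]: "C \<in> sets M" using C NM by auto
    have [measurable]: "point_count \<Phi> (B \<inter> W) \<in> measurable M (count_space UNIV)"
      using \<Phi>(1) BW by (auto simp: homogeneous_poisson_process_def)
    \<comment> \<open>On a rectangle the mark does not interact with the position, so the number of
      marked points factors.\<close>
    have eq: "ecount {x \<in> \<Phi> \<omega> \<inter> W. (x, \<omega>) \<in> B \<times> C} =
        of_nat (point_count \<Phi> (B \<inter> W) \<omega>) * indicator C \<omega>" if "\<omega> \<in> space M" for \<omega>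
    proof (cases "\<omega> \<in> C")
      case True
      hence "{x \<in> \<Phi> \<omega> \<inter> W. (x, \<omega>) \<in> B \<times> C} = \<Phi> \<omega> \<inter> (B \<inter> W)" by auto
      thus ?thesis using True fin[OF that]
        by (subst emeasure_count_space_finite)
          (auto simp: point_count_def intro: finite_subset[OF _ fin[OF that]])
    qed auto
    have RL: "B \<times> C \<inter> W \<times> space M = (B \<inter> W) \<times> C"
      using sets.sets_into_space[OF C] by auto
    have "emeasure ?L ((B \<inter> W) \<times> C) = emeasure lborel (B \<inter> W) * emeasure M C"
      using BW by (intro M.emeasure_pair_measure_Times) (auto simp: bounded_borel_def)
    hence "ennreal l * emeasure ?L (B \<times> C \<inter> W \<times> space M) =
        (\<integral>\<^sup>+\<omega>. of_nat (point_count \<Phi> (B \<inter> W) \<omega>) * indicator C \<omega> \<partial>M)"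
      using mean_count_on_independent_event[OF \<Phi> \<Psi>(2,1) BW C] RL by simp
    moreover have "(\<lambda>\<omega>. of_nat (point_count \<Phi> (B \<inter> W) \<omega>) * indicator C \<omega> :: ennreal)
        \<in> borel_measurable M"
      by measurable
    ultimately show ?thesis
      by (simp only: measurable_cong[OF eq] nn_integral_cong[OF eq])
  qed
  have stable: "Int_stable {B \<times> C |B C. B \<in> sets (borel::point measure) \<and> C \<in> sets ?N}"
    by (rule Int_stable_pair_measure_generator)
  have gen: "{B \<times> C |B C. B \<in> sets (borel::point measure) \<and> C \<in> sets ?N}
      \<subseteq> Pow (UNIV \<times> space M)"
    using sets.sets_into_space[of _ ?N] by auto
  have "S \<in> sigma_sets (UNIV \<times> space M) {B \<times> C |B C. B \<in> sets borel \<and> C \<in> sets ?N}"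
    using S by (simp add: sets_pair_measure)
  from stable gen this show ?thesis
  proof (induction rule: sigma_sets_induct_disjoint)
    case (basic A)
    then show ?case using rect by auto
  next
    case empty
    then show ?case by simp
  next
    \<comment> \<open>Complements are taken in \<open>UNIV \<times> space M\<close>, itself a
      rectangle. Subtraction is legitimate pointwise since \<open>\<Phi> \<omega> \<inter> W\<close>
      is finite, and for the integrals since \<open>W \<times> space M\<close> has finite
      measure.\<close>
    case (compl A)
    let ?c = "\<lambda>\<omega>. ecount {x \<in> \<Phi> \<omega> \<inter> W. (x, \<omega>) \<in> A}"
    have A: "A \<in> sets ?L"
      using compl sub by (simp add: sets_pair_measure)
    have full: "?P (UNIV \<times> space M)"
      using rect[of UNIV "space M"] sets.top[of ?N] by simp
    have c: "?c \<in> borel_measurable M"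
      and ic: "(\<integral>\<^sup>+\<omega>. ?c \<omega> \<partial>M) = ennreal l * emeasure ?L (A \<inter> W \<times> space M)"
      using compl by auto
    have AW: "emeasure ?L (A \<inter> W \<times> space M) \<noteq> \<infinity>"
      using emeasure_mono[of "A \<inter> W \<times> space M" "W \<times> space M" ?L] Wfin WL
      by (auto simp: less_top[symmetric] top_unique)
    have diff: "ecount {x \<in> \<Phi> \<omega> \<inter> W. (x, \<omega>) \<in> UNIV \<times> space M - A} =
        ecount {x \<in> \<Phi> \<omega> \<inter> W. (x, \<omega>) \<in> UNIV \<times> space M} - ?c \<omega>" if "\<omega> \<in> space M" for \<omega>
    proof -
      have "{x \<in> \<Phi> \<omega> \<inter> W. (x, \<omega>) \<in> UNIV \<times> space M - A} =
        {x \<in> \<Phi> \<omega> \<inter> W. (x, \<omega>) \<in> UNIV \<times> space M} - {x \<in> \<Phi> \<omega> \<inter> W. (x, \<omega>) \<in> A}"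
        by auto
      moreover have "?c \<omega> \<noteq> \<infinity>"
        by (subst emeasure_count_space_finite) (auto intro: finite_subset[OF _ fin[OF that]])
      ultimately show ?thesis using that
        by (simp only:) (rule emeasure_Diff, auto)
    qed
    have "(\<lambda>\<omega>. ecount {x \<in> \<Phi> \<omega> \<inter> W. (x, \<omega>) \<in> UNIV \<times> space M - A}) \<in> borel_measurable M"
      using c full by (subst measurable_cong[OF diff]) auto
    moreover have "(\<integral>\<^sup>+\<omega>. ecount {x \<in> \<Phi> \<omega> \<inter> W. (x, \<omega>) \<in> UNIV \<times> space M - A} \<partial>M) =
        (\<integral>\<^sup>+\<omega>. ecount {x \<in> \<Phi> \<omega> \<inter> W. (x, \<omega>) \<in> UNIV \<times> space M} \<partial>M) - (\<integral>\<^sup>+\<omega>. ?c \<omega> \<partial>M)"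
    proof (subst nn_integral_cong[OF diff], assumption, rule nn_integral_diff)
      show "(\<integral>\<^sup>+\<omega>. ?c \<omega> \<partial>M) \<noteq> \<infinity>"
        unfolding ic using AW by (simp add: ennreal_mult_eq_top_iff)
      show "AE \<omega> in M. ?c \<omega> \<le> ecount {x \<in> \<Phi> \<omega> \<inter> W. (x, \<omega>) \<in> UNIV \<times> space M}"
        by (intro AE_I2 emeasure_mono) auto
    qed (use c full in auto)
    moreover have "\<dots> = ennreal l *
        (emeasure ?L (UNIV \<times> space M \<inter> W \<times> space M) - emeasure ?L (A \<inter> W \<times> space M))"
      unfolding ic using full AW by (simp add: ennreal_right_diff_distrib)
    moreover have "emeasure ?L (UNIV \<times> space M \<inter> W \<times> space M) - emeasure ?L (A \<inter> W \<times> space M) =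
        emeasure ?L ((UNIV \<times> space M - A) \<inter> W \<times> space M)"
    proof -
      have "(UNIV \<times> space M - A) \<inter> W \<times> space M =
          (UNIV \<times> space M \<inter> W \<times> space M) - (A \<inter> W \<times> space M)" by auto
      moreover have "UNIV \<times> space M \<inter> W \<times> space M = W \<times> space M" by auto
      ultimately show ?thesis
        using A WL AW by (simp only:) (rule emeasure_Diff[symmetric], auto)
    qed
    ultimately show ?case by simp
  next
    case (union A)
    let ?c = "\<lambda>i \<omega>. ecount {x \<in> \<Phi> \<omega> \<inter> W. (x, \<omega>) \<in> A i}"
    have A: "A i \<in> sets ?L" for i
      using union sub by (auto simp: sets_pair_measure)
    have c: "?c i \<in> borel_measurable M"
      and ic: "(\<integral>\<^sup>+\<omega>. ?c i \<omega> \<partial>M) = ennreal l * emeasure ?L (A i \<inter> W \<times> space M)" for i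
      using union by auto
    have eq: "ecount {x \<in> \<Phi> \<omega> \<inter> W. (x, \<omega>) \<in> (\<Union>i. A i)} = (\<Sum>i. ?c i \<omega>)" for \<omega>
    proof -
      have "{x \<in> \<Phi> \<omega> \<inter> W. (x, \<omega>) \<in> (\<Union>i. A i)} = (\<Union>i. {x \<in> \<Phi> \<omega> \<inter> W. (x, \<omega>) \<in> A i})"
        by auto
      thus ?thesis using \<open>disjoint_family A\<close>
        by (simp only:) (rule suminf_emeasure[symmetric], auto simp: disjoint_family_on_def)
    qed
    have "(\<integral>\<^sup>+\<omega>. (\<Sum>i. ?c i \<omega>) \<partial>M) = (\<Sum>i. ennreal l * emeasure ?L (A i \<inter> W \<times> space M))"
      unfolding nn_integral_suminf[OF c] ic ..
    also have "\<dots> = ennreal l * (\<Sum>i. emeasure ?L (A i \<inter> W \<times> space M))"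
      by simp
    also have "(\<Sum>i. emeasure ?L (A i \<inter> W \<times> space M)) = emeasure ?L ((\<Union>i. A i) \<inter> W \<times> space M)"
      unfolding Int_UN_distrib2 Int_commute[of "\<Union>i. A i"]
      using A WL \<open>disjoint_family A\<close>
      by (subst suminf_emeasure) (auto simp: disjoint_family_on_def intro!: arg_cong[where f = "emeasure ?L"])
    finally show ?case unfolding eq using c by auto
  qed
qed

text \<open>Growing balls exhaust the plane, and monotone convergence removes the window on both
  sides, where infinite values are now allowed. Tonelli then turns the product measure into an
  integral over positions.\<close>

lemma campbell_independent_mark:
  assumes \<Phi>: "homogeneous_poisson_process M l \<Phi>" "l \<ge> 0"
    and \<Psi>: "homogeneous_poisson_process M l' \<Psi>" "indep_processes M \<Phi> \<Psi>"
    and S: "S \<in> sets (borel \<Otimes>\<^sub>M process_algebra M \<Psi>)"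
  shows "(\<lambda>\<omega>. ecount {x \<in> \<Phi> \<omega>. (x, \<omega>) \<in> S}) \<in> borel_measurable M"
    and "(\<integral>\<^sup>+\<omega>. ecount {x \<in> \<Phi> \<omega>. (x, \<omega>) \<in> S} \<partial>M) =
      ennreal l * (\<integral>\<^sup>+x. emeasure M {\<omega> \<in> space M. (x, \<omega>) \<in> S} \<partial>lborel)"
proof -
  interpret M: prob_space M using assms by (simp add: homogeneous_poisson_process_def)
  let ?L = "lborel \<Otimes>\<^sub>M M :: (point \<times> 'a) measure"
  define W :: "nat \<Rightarrow> point set" where "W n = ball 0 (real n)" for n
  have SL: "S \<in> sets ?L"
    using S sets_borel_process_algebra_subset[OF \<Psi>(1)] by blast
  have S_space: "S \<subseteq> UNIV \<times> space M"
    using sets.sets_into_space[OF S] by (simp add: space_pair_measure)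
  have W: "(\<Union>n. W n) = UNIV"
    unfolding W_def by (auto simp: reals_Archimedean2)
  have W_mono: "W m \<subseteq> W n" if "m \<le> n" for m n
    using that by (auto simp: W_def)
  note bounded = campbell_bounded[OF \<Phi> \<Psi> ball_bounded_borel S, of 0 "real n" for n, folded W_def]
  have eq: "ecount {x \<in> \<Phi> \<omega>. (x, \<omega>) \<in> S} = (SUP n. ecount {x \<in> \<Phi> \<omega> \<inter> W n. (x, \<omega>) \<in> S})" for \<omega>
  proof -
    have "{x \<in> \<Phi> \<omega>. (x, \<omega>) \<in> S} = (\<Union>n. {x \<in> \<Phi> \<omega> \<inter> W n. (x, \<omega>) \<in> S})"
      using W by auto
    moreover have "incseq (\<lambda>n. {x \<in> \<Phi> \<omega> \<inter> W n. (x, \<omega>) \<in> S})"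
      using W_mono by (force simp: incseq_def)
    ultimately show ?thesis
      by (simp only:) (rule SUP_emeasure_incseq[symmetric], auto)
  qed
  show "(\<lambda>\<omega>. ecount {x \<in> \<Phi> \<omega>. (x, \<omega>) \<in> S}) \<in> borel_measurable M"
    unfolding eq by (intro borel_measurable_SUP) (use bounded in auto)
  have "(\<integral>\<^sup>+\<omega>. ecount {x \<in> \<Phi> \<omega>. (x, \<omega>) \<in> S} \<partial>M) =
      (\<integral>\<^sup>+\<omega>. (SUP n. ecount {x \<in> \<Phi> \<omega> \<inter> W n. (x, \<omega>) \<in> S}) \<partial>M)"
    by (simp only: eq)
  also have "\<dots> = (SUP n. \<integral>\<^sup>+\<omega>. ecount {x \<in> \<Phi> \<omega> \<inter> W n. (x, \<omega>) \<in> S} \<partial>M)"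
  proof (rule nn_integral_monotone_convergence_SUP)
    show "incseq (\<lambda>n \<omega>. ecount {x \<in> \<Phi> \<omega> \<inter> W n. (x, \<omega>) \<in> S})"
      using W_mono by (intro incseq_SucI le_funI emeasure_mono) (force simp: W_def)+
  qed (use bounded in blast)
  also have "\<dots> = (SUP n. ennreal l * emeasure ?L (S \<inter> W n \<times> space M))"
    using bounded by simp
  also have "\<dots> = ennreal l * (SUP n. emeasure ?L (S \<inter> W n \<times> space M))"
    by (rule SUP_mult_left_ennreal[symmetric])
  also have "(SUP n. emeasure ?L (S \<inter> W n \<times> space M)) = emeasure ?L (\<Union>n. S \<inter> W n \<times> space M)"
  proof (rule SUP_emeasure_incseq)
    show "incseq (\<lambda>n. S \<inter> W n \<times> space M)"
      using W_mono by (force simp: incseq_def)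
    show "range (\<lambda>n. S \<inter> W n \<times> space M) \<subseteq> sets ?L"
      using SL by (auto simp: W_def)
  qed
  also have "(\<Union>n. S \<inter> W n \<times> space M) = S"
    using W S_space by auto
  also have "emeasure ?L S = (\<integral>\<^sup>+x. emeasure M (Pair x -` S) \<partial>lborel)"
    by (rule M.emeasure_pair_measure_alt[OF SL])
  also have "\<dots> = (\<integral>\<^sup>+x. emeasure M {\<omega> \<in> space M. (x, \<omega>) \<in> S} \<partial>lborel)"
    using S_space by (intro nn_integral_cong arg_cong[where f = "emeasure M"]) auto
  finally show "(\<integral>\<^sup>+\<omega>. ecount {x \<in> \<Phi> \<omega>. (x, \<omega>) \<in> S} \<partial>M) =
      ennreal l * (\<integral>\<^sup>+x. emeasure M {\<omega> \<in> space M. (x, \<omega>) \<in> S} \<partial>lborel)" .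
qed


section \<open>The distance to the nearest point\<close>

text \<open>\<open>nearest\<close> is a choice operator and says something only once a minimum is
  known to exist; local finiteness provides it. In terms of \<open>infdist\<close>, ties between
  eavesdroppers no longer matter.\<close>

lemma locally_finite_nearest:
  fixes E :: "point set"
  assumes fin: "\<And>B. bounded B \<Longrightarrow> finite (E \<inter> B)" and E: "E \<noteq> {}"
  shows "nearest E x \<in> E" and "dist x (nearest E x) = infdist x E"
proof -
  obtain e0 where e0: "e0 \<in> E" using E by auto
  \<comment> \<open>Points farther away than some fixed \<open>e0\<close> cannot be nearest, so the
    search is confined to a finite set.\<close>
  define K where "K = E \<inter> cball x (dist x e0)"
  have K: "finite K" "e0 \<in> K" using e0 by (auto simp: K_def intro: fin)
  obtain m where m: "m \<in> K" "\<And>e. e \<in> K \<Longrightarrow> dist x m \<le> dist x e"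
    using K arg_min_if_finite[of K "dist x"] by (metis empty_iff linorder_not_less)
  have "dist x m \<le> dist x e" if "e \<in> E" for e
    using m(2)[OF K(2)] m(2)[of e] that by (cases "e \<in> K") (auto simp: K_def)
  hence "is_arg_min (dist x) (\<lambda>e. e \<in> E) m"
    using m(1) by (auto simp: is_arg_min_linorder K_def)
  hence "is_arg_min (dist x) (\<lambda>e. e \<in> E) (nearest E x)"
    unfolding nearest_def arg_min_on_def arg_min_def by (rule someI)
  hence n: "nearest E x \<in> E" "\<And>e. e \<in> E \<Longrightarrow> dist x (nearest E x) \<le> dist x e"
    by (auto simp: is_arg_min_linorder)
  thus "nearest E x \<in> E" by simp
  show "dist x (nearest E x) = infdist x E"
    using n E by (intro antisym infdist_le) (auto simp: infdist_notempty intro: cINF_greatest)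
qed

text \<open>A point of \<open>\<Phi> \<omega>\<close> lies within less than \<open>t\<close> of
  \<open>x\<close> iff, for some \<open>q\<close> in a countable dense set and some rational
  \<open>s\<close>, \<open>x\<close> is in \<open>ball q s\<close> and the process hits
  \<open>ball q (t - s)\<close>. This writes the sublevel set as a countable union of rectangles, up
  to empty configurations.\<close>

lemma measurable_infdist_poisson:
  assumes "homogeneous_poisson_process M l \<Phi>"
  shows "(\<lambda>(x, \<omega>). infdist x (\<Phi> \<omega>)) \<in> borel_measurable (borel \<Otimes>\<^sub>M process_algebra M \<Phi>)"
proof (rule borel_measurableI_less)
  fix t :: real
  let ?N = "process_algebra M \<Phi>" and ?Q = "borel \<Otimes>\<^sub>M process_algebra M \<Phi> :: (point \<times> 'a) measure"
  obtain D :: "point set" where D: "countable D" "\<And>X. open X \<Longrightarrow> X \<noteq> {} \<Longrightarrow> \<exists>d\<in>D. d \<in> X"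
    by (rule countable_dense_setE) blast
  define hit where "hit q r = {\<omega> \<in> space M. \<Phi> \<omega> \<inter> ball q r \<noteq> {}}" for q r
  have hit: "hit q r \<in> sets ?N" for q r
    unfolding hit_def by (rule hitting_event_in_process_algebra[OF assms ball_bounded_borel])
  \<comment> \<open>The void event is needed because \<^term>\<open>infdist x {} = 0\<close>.\<close>
  define void where "void = space ?N - (\<Union>n. hit 0 (real n))"
  have void: "void \<in> sets ?N"
    unfolding void_def using hit by (intro sets.compl_sets sets.countable_UN) auto
  have void_eq: "\<omega> \<in> void \<longleftrightarrow> \<omega> \<in> space M \<and> \<Phi> \<omega> = {}" for \<omega>
  proof -
    have "(\<Union>n. \<Phi> \<omega> \<inter> ball 0 (real n)) = \<Phi> \<omega>" by (auto simp: reals_Archimedean2)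
    thus ?thesis by (auto simp: void_def hit_def)
  qed
  have "{w \<in> space ?Q. (case w of (x, \<omega>) \<Rightarrow> infdist x (\<Phi> \<omega>)) < t} =
      (if t > 0 then UNIV \<times> void \<union> (\<Union>q\<in>D. \<Union>s\<in>\<rat>. ball q s \<times> hit q (t - s)) else {})"
    (is "?A = ?B")
  proof (intro set_eqI iffI)
    fix w assume "w \<in> ?A"
    then obtain x \<omega> where w: "w = (x, \<omega>)" "\<omega> \<in> space M" "infdist x (\<Phi> \<omega>) < t"
      by (auto simp: space_pair_measure)
    hence t: "t > 0" using infdist_nonneg[of x "\<Phi> \<omega>"] by linarith
    show "w \<in> ?B"
    proof (cases "\<Phi> \<omega> = {}")
      case True
      thus ?thesis using t w void_eq by auto
    next
      case False
      then obtain e where e: "e \<in> \<Phi> \<omega>" "dist x e < t"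
        using w(3) by (auto simp: infdist_notempty cINF_less_iff)
      \<comment> \<open>Half of the slack suffices:
        \<open>dist q e < s + dist x e < t - s\<close>.\<close>
      obtain s where s: "s \<in> \<rat>" "0 < s" "s < (t - dist x e) / 2"
        using Rats_dense_in_real[of 0 "(t - dist x e) / 2"] e by auto
      obtain q where q: "q \<in> D" "q \<in> ball x s" using D(2)[of "ball x s"] s by auto
      have "dist q e < t - s"
        using q s dist_triangle[of q e x] by (simp add: dist_commute field_simps)
      hence "w \<in> ball q s \<times> hit q (t - s)"
        using w e q by (auto simp: hit_def dist_commute)
      thus ?thesis using t s(1) q(1) by auto
    qed
  next
    fix w assume B: "w \<in> ?B"
    then obtain x \<omega> where w: "w = (x, \<omega>)" by (cases w)
    from B have t: "t > 0" by (auto split: if_splits)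
    from B t w consider "\<omega> \<in> void" | q s where "x \<in> ball q s" "\<omega> \<in> hit q (t - s)" by auto
    thus "w \<in> ?A"
    proof cases
      case 1
      thus ?thesis using w t void_eq by (auto simp: space_pair_measure infdist_def)
    next
      case 2
      then obtain e where e: "e \<in> \<Phi> \<omega>" "dist q e < t - s" and \<omega>: "\<omega> \<in> space M"
        by (auto simp: hit_def)
      have "infdist x (\<Phi> \<omega>) \<le> dist x e" by (rule infdist_le[OF e(1)])
      also have "\<dots> < t"
        using dist_triangle[of x e q] e 2 by (simp add: dist_commute)
      finally show ?thesis using w \<omega> by (auto simp: space_pair_measure)
    qed
  qed
  moreover have "?B \<in> sets ?Q"
    using D(1) hit void by (auto intro!: sets.Un sets.countable_UN' countable_rat)
  ultimately show "{w \<in> space ?Q. (case w of (x, \<omega>) \<Rightarrow> infdist x (\<Phi> \<omega>)) < t} \<in> sets ?Q"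
    by simp
qed

lemma measurable_infdist_poisson_fixed:
  assumes "homogeneous_poisson_process M l \<Phi>"
  shows "(\<lambda>\<omega>. infdist x (\<Phi> \<omega>)) \<in> borel_measurable (process_algebra M \<Phi>)"
  using measurable_compose[OF measurable_Pair1' measurable_infdist_poisson[OF assms], of x] by simp

lemma measurable_infdist_poisson_space:
  assumes "homogeneous_poisson_process M l \<Phi>"
  shows "(\<lambda>\<omega>. infdist x (\<Phi> \<omega>)) \<in> borel_measurable M"
proof (rule measurable_mono[THEN subsetD, OF _ _ _ _ measurable_infdist_poisson_fixed[OF assms]])
qed (use sets_process_algebra_subset[OF assms] in auto)

text \<open>The distance exceeds \<open>t\<close> when the closed disc of radius \<open>t\<close> is
  void, and that probability depends on its area but not on its centre. Equal distribution functions
  then give equal laws.\<close>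

lemma contact_distribution_translation_invariant:
  assumes \<Phi>: "homogeneous_poisson_process M l \<Phi>" "l > 0"
  shows "distr M borel (\<lambda>\<omega>. infdist x (\<Phi> \<omega>)) = distr M borel (\<lambda>\<omega>. infdist y (\<Phi> \<omega>))"
proof -
  interpret prob_space M using \<Phi> by (simp add: homogeneous_poisson_process_def)
  have [measurable]: "(\<lambda>\<omega>. infdist x (\<Phi> \<omega>)) \<in> borel_measurable M" for x
    by (rule measurable_infdist_poisson_space[OF \<Phi>(1)])
  have cdf: "cdf (distr M borel (\<lambda>\<omega>. infdist x (\<Phi> \<omega>))) t =
      (if t < 0 then 0 else 1 - exp (- (l * (unit_ball_vol 2 * t ^ 2))))" for x t
  proof -
    have "cdf (distr M borel (\<lambda>\<omega>. infdist x (\<Phi> \<omega>))) t = prob {\<omega> \<in> space M. infdist x (\<Phi> \<omega>) \<le> t}"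
      by (auto simp: cdf_def measure_distr intro!: arg_cong[where f = prob])
    also have "\<dots> = (if t < 0 then 0 else 1 - exp (- (l * (unit_ball_vol 2 * t ^ 2))))"
    proof (cases "t < 0")
      case True
      hence "{\<omega> \<in> space M. infdist x (\<Phi> \<omega>) \<le> t} = {}"
        using infdist_nonneg[of x] by (auto simp: not_le intro: less_le_trans)
      thus ?thesis using True by (simp only:) simp
    next
      case False
      let ?V = "{\<omega> \<in> space M. \<Phi> \<omega> \<inter> cball x t = {}}"
      have V: "?V \<in> events" by (rule void_event_in_sets[OF \<Phi>(1) cball_bounded_borel])
      \<comment> \<open>Only almost surely: for an empty configuration \<open>infdist\<close> is 0
        although the disc is void. Otherwise the infimum is attained, which matches
        \<open>\<le>\<close> with the closed disc.\<close>
      have "AE \<omega> in M. infdist x (\<Phi> \<omega>) \<le> t \<longleftrightarrow> \<omega> \<in> space M - ?V"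
        using AE_poisson_nonempty[OF \<Phi>]
      proof (rule AE_mp, intro AE_I2 impI)
        fix \<omega> assume \<omega>: "\<omega> \<in> space M" "\<Phi> \<omega> \<noteq> {}"
        have n: "nearest (\<Phi> \<omega>) x \<in> \<Phi> \<omega>" "dist x (nearest (\<Phi> \<omega>) x) = infdist x (\<Phi> \<omega>)"
          using locally_finite_nearest[of "\<Phi> \<omega>" x] \<Phi>(1) \<omega>
          by (auto simp: homogeneous_poisson_process_def)
        have "infdist x (\<Phi> \<omega>) \<le> t \<longleftrightarrow> \<Phi> \<omega> \<inter> cball x t \<noteq> {}"
        proof
          assume "infdist x (\<Phi> \<omega>) \<le> t"
          hence "nearest (\<Phi> \<omega>) x \<in> \<Phi> \<omega> \<inter> cball x t" using n by simp
          thus "\<Phi> \<omega> \<inter> cball x t \<noteq> {}" by blast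
        next
          assume "\<Phi> \<omega> \<inter> cball x t \<noteq> {}"
          then obtain e where "e \<in> \<Phi> \<omega>" "dist x e \<le> t" by auto
          thus "infdist x (\<Phi> \<omega>) \<le> t" using infdist_le[of e "\<Phi> \<omega>" x] by linarith
        qed
        thus "infdist x (\<Phi> \<omega>) \<le> t \<longleftrightarrow> \<omega> \<in> space M - ?V" using \<omega> by auto
      qed
      hence "prob {\<omega> \<in> space M. infdist x (\<Phi> \<omega>) \<le> t} = prob (space M - ?V)"
        using V by (intro finite_measure_eq_AE) (auto elim!: eventually_mono)
      also have "\<dots> = 1 - prob ?V" by (rule prob_compl[OF V])
      also have "prob ?V = exp (- (l * (unit_ball_vol 2 * t ^ 2)))"
        using False void_probability[OF \<Phi>(1) cball_bounded_borel] by (simp add: content_cball)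
      finally show ?thesis using False by simp
    qed
    finally show ?thesis .
  qed
  have "real_distribution (distr M borel (\<lambda>\<omega>. infdist x (\<Phi> \<omega>)))" for x
    by (intro real_distribution_distr) measurable
  thus ?thesis by (intro cdf_unique) (auto simp: cdf)
qed


section \<open>Mean degrees\<close>

text \<open>
  The values of \<open>g\<close> outside the positive reals are unspecified and not even assumed measurable;
  replacing them by \<open>0\<close> changes the degrees only on null events.
\<close>

definition gain :: "(real \<Rightarrow> real) \<Rightarrow> real \<Rightarrow> real" where
  "gain g r = indicator {0<..} r * g r"

text \<open>The edge condition with link length \<open>r\<close> and eavesdropper distance
  \<open>d\<close> as free arguments, so that one predicate serves both degrees.\<close>

definition secure :: "(real \<Rightarrow> real) \<Rightarrow> real \<Rightarrow> real \<Rightarrow> real \<Rightarrow> real \<Rightarrow> real \<Rightarrow> real \<Rightarrow> bool" where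
  "secure g P rho sl se r d \<longleftrightarrow>
     gain g r > sl / se * 2 powr rho * gain g d + sl / P * (2 powr rho - 1)"

lemma gain_nonneg: "\<forall>r>0. g r > 0 \<Longrightarrow> gain g r \<ge> 0"
  by (auto simp: gain_def indicator_def intro: less_imp_le)

lemma measurable_gain:
  assumes "continuous_on {0<..} g"
  shows "gain g \<in> borel_measurable borel"
  unfolding gain_def[abs_def]
  using borel_measurable_continuous_on_indicator[OF _ assms] by simp

lemma secure_measurable:
  assumes g: "continuous_on {0<..} g"
    and [measurable]: "r \<in> borel_measurable K" "d \<in> borel_measurable K"
  shows "{w \<in> space K. secure g P rho sl se (r w) (d w)} \<in> sets K"
proof -
  note [measurable] = measurable_gain[OF g]
  show ?thesis unfolding secure_def by measurable
qed

text \<open>The in-degree has every legitimate node as a transmitter, so all of them must avoid the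
  eavesdroppers simultaneously. By Campbell's formula the expected number of common points is an
  integral of probabilities that a fixed point belongs to \<open>\<Psi>\<close>, all of them
  zero.\<close>

lemma AE_no_common_point:
  assumes \<Phi>: "homogeneous_poisson_process M l \<Phi>" "l \<ge> 0"
    and \<Psi>: "homogeneous_poisson_process M l' \<Psi>" "l' > 0" "indep_processes M \<Phi> \<Psi>"
  shows "AE \<omega> in M. \<Phi> \<omega> \<inter> \<Psi> \<omega> = {}"
proof -
  interpret prob_space M using \<Phi> by (simp add: homogeneous_poisson_process_def)
  let ?Q = "borel \<Otimes>\<^sub>M process_algebra M \<Psi> :: (point \<times> 'a) measure"
  \<comment> \<open>Membership in \<open>\<Psi> \<omega>\<close> is encoded by distance zero, whose
    joint measurability is known; the two differ only for empty configurations.\<close>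
  define S where "S = {w \<in> space ?Q. infdist (fst w) (\<Psi> (snd w)) = 0}"
  have [measurable]: "(\<lambda>w. infdist (fst w) (\<Psi> (snd w))) \<in> borel_measurable ?Q"
    using measurable_infdist_poisson[OF \<Psi>(1)] by (simp add: split_beta')
  have S: "S \<in> sets ?Q" unfolding S_def by measurable
  have near0: "infdist x (\<Psi> \<omega>) = 0 \<longleftrightarrow> x \<in> \<Psi> \<omega>" if "\<omega> \<in> space M" "\<Psi> \<omega> \<noteq> {}" for x \<omega>
    using locally_finite_nearest[of "\<Psi> \<omega>" x] \<Psi>(1) that infdist_zero[of x "\<Psi> \<omega>"]
    by (auto simp: homogeneous_poisson_process_def)
  have null: "emeasure M {\<omega> \<in> space M. (x, \<omega>) \<in> S} = 0" for x
  proof -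
    have "AE \<omega> in M. (x, \<omega>) \<notin> S"
      using AE_poisson_nonempty[OF \<Psi>(1,2)] AE_point_notin_poisson[OF \<Psi>(1), of x] AE_space
      by eventually_elim (auto simp: S_def near0)
    thus ?thesis by (rule emeasure_eq_0_AE)
  qed
  have "(\<integral>\<^sup>+\<omega>. ecount {x \<in> \<Phi> \<omega>. (x, \<omega>) \<in> S} \<partial>M) = 0"
    by (simp add: campbell_independent_mark(2)[OF \<Phi> \<Psi>(1,3) S] null)
  hence "AE \<omega> in M. ecount {x \<in> \<Phi> \<omega>. (x, \<omega>) \<in> S} = 0"
    using campbell_independent_mark(1)[OF \<Phi> \<Psi>(1,3) S] by (subst (asm) nn_integral_0_iff_AE) auto
  thus ?thesis
    using AE_poisson_nonempty[OF \<Psi>(1,2)] AE_space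
  proof eventually_elim
    case (elim \<omega>)
    have "{x \<in> \<Phi> \<omega>. (x, \<omega>) \<in> S} = {}"
      using elim(1) by (simp add: emeasure_count_space_eq_0)
    thus ?case using elim near0 by (auto simp: S_def space_pair_measure)
  qed
qed

lemma edge_iff_secure:
  fixes E :: "point set"
  assumes "\<And>B. bounded B \<Longrightarrow> finite (E \<inter> B)" "E \<noteq> {}" "x \<notin> E" "x \<noteq> y" "x \<in> V" "y \<in> V"
  shows "(x, y) \<in> iS_graph g P rho sl se V E \<longleftrightarrow> secure g P rho sl se (dist x y) (infdist x E)"
proof -
  note n = locally_finite_nearest[OF assms(1,2), of x]
  have "infdist x E > 0" using n assms(3) by (metis zero_less_dist_iff)
  thus ?thesis using assms(4-6) n by (simp add: iS_graph_def secure_def gain_def)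
qed

lemma mean_degrees_formula:
  assumes \<Phi>: "homogeneous_poisson_process M ll \<Phi>l" "ll \<ge> 0"
    and \<Psi>: "homogeneous_poisson_process M le \<Phi>e" "le > 0" "indep_processes M \<Phi>l \<Phi>e"
    and params: "P > 0" "rho \<ge> 0" "sl > 0" "se > 0"
    and g: "\<forall>r>0. g r > 0" "continuous_on {0<..} g"
  defines "F \<equiv> ennreal ll *
    (\<integral>\<^sup>+x. emeasure M
      {\<omega> \<in> space M. secure g P rho sl se (norm (x::point)) (infdist 0 (\<Phi>e \<omega>))} \<partial>lborel)"
  shows "mean_out_degree M \<Phi>l \<Phi>e g P rho sl se = F"
    and "mean_in_degree M \<Phi>l \<Phi>e g P rho sl se = F"
proof -
  interpret prob_space M using \<Phi> by (simp add: homogeneous_poisson_process_def)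
  let ?N = "process_algebra M \<Phi>e" and ?Q = "borel \<Otimes>\<^sub>M process_algebra M \<Phi>e :: (point \<times> 'a) measure"
  let ?s = "secure g P rho sl se"
  \<comment> \<open>A legitimate node at the origin yields no edge, as edges join distinct nodes.
    Since \<open>gain g 0 = 0\<close> and \<open>rho \<ge> 0\<close> makes the threshold
    nonnegative, \<open>secure\<close> fails there too, and no exceptional event is needed for this
    case.\<close>
  have not0: "\<not> ?s 0 d" for d
  proof -
    have "2 powr rho \<ge> 1" using params by (simp add: ge_one_powr_ge_zero)
    hence "sl / se * 2 powr rho * gain g d + sl / P * (2 powr rho - 1) \<ge> 0"
      using params gain_nonneg[OF g(1)] by simp
    thus ?thesis by (simp add: secure_def gain_def)
  qed
  have fin: "finite (\<Phi>e \<omega> \<inter> B)" if "\<omega> \<in> space M" "bounded B" for \<omega> B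
    using \<Psi>(1) that by (simp add: homogeneous_poisson_process_def)
  have [measurable]: "(\<lambda>w. infdist (fst w) (\<Phi>e (snd w))) \<in> borel_measurable ?Q"
    using measurable_infdist_poisson[OF \<Psi>(1)] by (simp add: split_beta')
  have [measurable]: "(\<lambda>\<omega>. infdist x (\<Phi>e \<omega>)) \<in> borel_measurable ?N" for x
    by (rule measurable_infdist_poisson_fixed[OF \<Psi>(1)])
  have M1[measurable]: "(\<lambda>\<omega>. infdist x (\<Phi>e \<omega>)) \<in> borel_measurable M" for x
    by (rule measurable_infdist_poisson_space[OF \<Psi>(1)])

  have "mean_out_degree M \<Phi>l \<Phi>e g P rho sl se = (\<integral>\<^sup>+\<omega>. ecount {x \<in> \<Phi>l \<omega>.
      (x, \<omega>) \<in> {w \<in> space ?Q. ?s (norm (fst w)) (infdist 0 (\<Phi>e (snd w)))}} \<partial>M)"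
    unfolding mean_out_degree_def N_out_def
  proof (rule nn_integral_cong_AE)
    show "AE \<omega> in M. ecount {x \<in> \<Phi>l \<omega>. (0, x) \<in> iS_graph g P rho sl se (\<Phi>l \<omega> \<union> {0}) (\<Phi>e \<omega>)} =
      ecount {x \<in> \<Phi>l \<omega>. (x, \<omega>) \<in> {w \<in> space ?Q. ?s (norm (fst w)) (infdist 0 (\<Phi>e (snd w)))}}"
      using AE_poisson_nonempty[OF \<Psi>(1,2)] AE_point_notin_poisson[OF \<Psi>(1), of 0] AE_space
    proof eventually_elim
      case (elim \<omega>)
      have "(0, x) \<in> iS_graph g P rho sl se (\<Phi>l \<omega> \<union> {0}) (\<Phi>e \<omega>) \<longleftrightarrow>
          ?s (norm x) (infdist 0 (\<Phi>e \<omega>))" if "x \<in> \<Phi>l \<omega>" for x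
      proof (cases "x = 0")
        case True
        thus ?thesis using not0 by (simp add: iS_graph_def)
      next
        case False
        thus ?thesis using elim that
          by (subst edge_iff_secure) (auto intro: fin)
      qed
      thus ?case using elim by (intro arg_cong[where f = ecount]) (auto simp: space_pair_measure)
    qed
  qed
  also have "\<dots> = F"
  proof (subst campbell_independent_mark(2)[OF \<Phi> \<Psi>(1,3)])
    show "{w \<in> space ?Q. ?s (norm (fst w)) (infdist 0 (\<Phi>e (snd w)))} \<in> sets ?Q"
      by (rule secure_measurable[OF g(2)]) measurable
  qed (simp add: F_def space_pair_measure cong: conj_cong)
  finally show "mean_out_degree M \<Phi>l \<Phi>e g P rho sl se = F" .

  have "mean_in_degree M \<Phi>l \<Phi>e g P rho sl se = (\<integral>\<^sup>+\<omega>. ecount {x \<in> \<Phi>l \<omega>.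
      (x, \<omega>) \<in> {w \<in> space ?Q. ?s (norm (fst w)) (infdist (fst w) (\<Phi>e (snd w)))}} \<partial>M)"
    unfolding mean_in_degree_def N_in_def
  proof (rule nn_integral_cong_AE)
    show "AE \<omega> in M. ecount {x \<in> \<Phi>l \<omega>. (x, 0) \<in> iS_graph g P rho sl se (\<Phi>l \<omega> \<union> {0}) (\<Phi>e \<omega>)} =
      ecount {x \<in> \<Phi>l \<omega>. (x, \<omega>) \<in> {w \<in> space ?Q. ?s (norm (fst w)) (infdist (fst w) (\<Phi>e (snd w)))}}"
      using AE_poisson_nonempty[OF \<Psi>(1,2)] AE_no_common_point[OF \<Phi> \<Psi>] AE_space
    proof eventually_elim
      case (elim \<omega>)
      have "(x, 0) \<in> iS_graph g P rho sl se (\<Phi>l \<omega> \<union> {0}) (\<Phi>e \<omega>) \<longleftrightarrow>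
          ?s (norm x) (infdist x (\<Phi>e \<omega>))" if "x \<in> \<Phi>l \<omega>" for x
      proof (cases "x = 0")
        case True
        thus ?thesis using not0 by (simp add: iS_graph_def)
      next
        case False
        thus ?thesis using elim that
          by (subst edge_iff_secure) (auto intro: fin)
      qed
      thus ?case using elim by (intro arg_cong[where f = ecount]) (auto simp: space_pair_measure)
    qed
  qed
  also have "\<dots> = ennreal ll *
      (\<integral>\<^sup>+x. emeasure M {\<omega> \<in> space M. ?s (norm x) (infdist x (\<Phi>e \<omega>))} \<partial>lborel)"
  proof (subst campbell_independent_mark(2)[OF \<Phi> \<Psi>(1,3)])
    show "{w \<in> space ?Q. ?s (norm (fst w)) (infdist (fst w) (\<Phi>e (snd w)))} \<in> sets ?Q"
      by (rule secure_measurable[OF g(2)]) measurable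
  qed (simp add: space_pair_measure cong: conj_cong)
  also have "\<dots> = F"
  proof -
    \<comment> \<open>Passing to the image measure exposes the law of the eavesdropper distance. Its
      base point can then move from \<open>x\<close> to \<open>0\<close> while the link length
      \<open>r\<close> stays fixed.\<close>
    have law: "emeasure M {\<omega> \<in> space M. ?s r (infdist y (\<Phi>e \<omega>))} =
        emeasure (distr M borel (\<lambda>\<omega>. infdist y (\<Phi>e \<omega>))) {d. ?s r d}" for r y
    proof -
      have "{d \<in> space borel. ?s r d} \<in> sets borel"
        by (rule secure_measurable[OF g(2)]) measurable
      thus ?thesis
        by (subst emeasure_distr) (auto intro!: arg_cong[where f = "emeasure M"])
    qed
    have "emeasure M {\<omega> \<in> space M. ?s r (infdist x (\<Phi>e \<omega>))} =
        emeasure M {\<omega> \<in> space M. ?s r (infdist 0 (\<Phi>e \<omega>))}" for r x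
      unfolding law by (subst contact_distribution_translation_invariant[OF \<Psi>(1,2), of x 0]) (rule refl)
    thus ?thesis
      unfolding F_def by (intro arg_cong[where f = "(*) (ennreal ll)"] nn_integral_cong)
  qed
  finally show "mean_in_degree M \<Phi>l \<Phi>e g P rho sl se = F" .
qed

section \<open>Monotonicity in the parameters\<close>

lemma secure_mono:
  assumes g: "\<forall>r>0. g r > 0" and P: "P > 0"
    and rho: "0 \<le> rho" "rho \<le> rho'" and sl: "0 < sl" "sl \<le> sl'" and se: "0 < se'" "se' \<le> se"
    and s: "secure g P rho' sl' se' r d"
  shows "secure g P rho sl se r d"
proof -
  \<comment> \<open>The lower bound makes the factor \<open>2 powr rho - 1\<close> nonnegative,
    without which the noise term would not grow with \<open>sl\<close>.\<close>
  have p: "1 \<le> 2 powr rho" "2 powr rho \<le> 2 powr rho'"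
    using rho by (simp_all add: ge_one_powr_ge_zero)
  have "sl / se * 2 powr rho * gain g d \<le> sl' / se' * 2 powr rho' * gain g d"
    using p sl se gain_nonneg[OF g, of d] by (intro mult_mono frac_le) auto
  moreover have "sl / P * (2 powr rho - 1) \<le> sl' / P * (2 powr rho' - 1)"
    using p sl P by (intro mult_mono divide_right_mono) auto
  ultimately show ?thesis using s by (simp add: secure_def)
qed

text \<open>The comparison is made in the integral formula, where the events are nested for every
  \<open>x\<close>; for the graphs themselves, \<open>g 0\<close> could spoil the inclusion of edges
  on a null event.\<close>

lemma mean_out_degree_mono:
  assumes \<Phi>: "homogeneous_poisson_process M ll \<Phi>l" "ll \<ge> 0"
    and \<Psi>: "homogeneous_poisson_process M le \<Phi>e" "le > 0" "indep_processes M \<Phi>l \<Phi>e"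
    and g: "\<forall>r>0. g r > 0" "continuous_on {0<..} g" and P: "P > 0"
    and rho: "0 \<le> rho" "rho \<le> rho'" and sl: "0 < sl" "sl \<le> sl'" and se: "0 < se'" "se' \<le> se"
  shows "mean_out_degree M \<Phi>l \<Phi>e g P rho' sl' se' \<le> mean_out_degree M \<Phi>l \<Phi>e g P rho sl se"
proof -
  have pos: "rho' \<ge> 0" "sl' > 0" "se > 0" using rho sl se by auto
  have "{\<omega> \<in> space M. secure g P rho sl se (norm x) (infdist 0 (\<Phi>e \<omega>))} \<in> sets M" for x :: point
    by (intro secure_measurable[OF g(2)] measurable_infdist_poisson_space[OF \<Psi>(1)]) auto
  thus ?thesis
    unfolding mean_degrees_formula(1)[OF \<Phi> \<Psi> P rho(1) sl(1) pos(3) g]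
      mean_degrees_formula(1)[OF \<Phi> \<Psi> P pos(1,2) se(1) g]
    by (intro mult_left_mono nn_integral_mono emeasure_mono)
      (auto intro: secure_mono[OF g(1) P rho sl se])
qed

theorem mainTheorem6:
  fixes M :: "'w measure" and \<Phi>l \<Phi>e :: "'w \<Rightarrow> point set"
    and ll le P rho sl se :: real and g :: "real \<Rightarrow> real"
  assumes "ll > 0" and "le > 0"
    and "homogeneous_poisson_process M ll \<Phi>l"
    and "homogeneous_poisson_process M le \<Phi>e"
    and "indep_processes M \<Phi>l \<Phi>e"
    and "P > 0" and "rho \<ge> 0" and "sl > 0" and "se > 0"
    and "\<forall>r>0. g r > 0"
    and "continuous_on {0<..} g"
    and "strict_antimono_on {0<..} g"
    and "(g \<longlongrightarrow> 0) at_top"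
  shows "mean_out_degree M \<Phi>l \<Phi>e g P rho sl se = mean_in_degree M \<Phi>l \<Phi>e g P rho sl se \<and>
    antimono_on {0..} (\<lambda>rho'. mean_out_degree M \<Phi>l \<Phi>e g P rho' sl se) \<and>
    antimono_on {0..} (\<lambda>rho'. mean_in_degree M \<Phi>l \<Phi>e g P rho' sl se) \<and>
    antimono_on {0<..} (\<lambda>sl'. mean_out_degree M \<Phi>l \<Phi>e g P rho sl' se) \<and>
    antimono_on {0<..} (\<lambda>sl'. mean_in_degree M \<Phi>l \<Phi>e g P rho sl' se) \<and>
    mono_on {0<..} (\<lambda>se'. mean_out_degree M \<Phi>l \<Phi>e g P rho sl se') \<and>
    mono_on {0<..} (\<lambda>se'. mean_in_degree M \<Phi>l \<Phi>e g P rho sl se')"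
proof -
  note formula = mean_degrees_formula[OF assms(3) less_imp_le[OF assms(1)] assms(4,2,5,6)]
  note mono = mean_out_degree_mono[OF assms(3) less_imp_le[OF assms(1)] assms(4,2,5,10,11,6)]
  \<comment> \<open>Stated for all admissible parameters, so that monotonicity of the out-degree
    carries over to the in-degree as a function.\<close>
  have eq: "mean_in_degree M \<Phi>l \<Phi>e g P rho' sl' se' = mean_out_degree M \<Phi>l \<Phi>e g P rho' sl' se'"
    if "rho' \<ge> 0" "sl' > 0" "se' > 0" for rho' sl' se'
    using formula[OF that assms(10,11)] by simp
  show ?thesis
    using assms(7-9) by (auto simp: eq intro!: monotone_onI mono)
qed

end
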